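(* Let $X$ be a (nonempty) $T_{3.5}$ space, and let $\mathbf 0\in C_p(X)$ be the constant zero function. The following are equivalent. (a) Player II has a winning strategy in $G_1(\mathcal O_X,\mathcal O_X)$. (b) Player II has a winning strategy in $G_1(\Omega_X,\Omega_X)$. (c) Player I has a winning strategy in $PO(X)$. (d) Player I has a winning strategy in $FO(X)$. (e) Player I has a winning strategy in $\Omega FO(X)$. (f) Player I has a winning strategy in Gruenhage's $W$-game on $C_p(X)$ at $\mathbf 0$. (g) Player I has a winning strategy in Gruenhage's clustering game on $C_p(X)$ at $\mathbf 0$. (h) Player I has a winning strategy in $CL(C_p(X),\mathbf 0)$. (i) Player I has a winning strategy in $CD(C_p(X))$. (j) Player II has a winning strategy in $G_1(\Omega_{C_p(X),\mathbf 0},\Omega_{C_p(X),\mathbf 0})$. (k) Player II has a winning strategy in $G_1(\mathcal D_{C_p(X)},\Omega_{C_p(X),\mathbf 0})$.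
   Context: Spaces are nonempty. $C_p(X)$ is the space of continuous functions $X\to\mathbb R$ with the topology of pointwise convergence; $T_{3.5}$ means completely regular and $T_1$. $\omega=\{0,1,2,\dots\}$. Collections. $\mathcal O_X$ is the collection of open covers of $X$. An $\omega$-cover of $X$ is an open cover $\mathcal U$ such that every finite $F\subseteq X$ is contained in some $U\in\mathcal U$; $\Omega_X$ is the collection of $\omega$-covers of $X$. For a space $Y$ and $y\in Y$, $\Omega_{Y,y}$ is the collection of $A\subseteq Y$ with $y\in\overline A$, and $\mathcal D_Y$ is the collection of dense subsets of $Y$. Games (all of length $\omega$; in round $n$ player I moves first, then player II). - $G_1(\mathcal A,\mathcal B)$: I chooses $A_n\in\mathcal A$, then II chooses $b_n\in A_n$; II wins if $\{b_n:n<\omega\}\in\mathcal B$, otherwise I wins. - $PO(X)$ (point-open game): I plays a point $x_n\in X$, II plays an open set $U_n\ni x_n$. I wins if $X=\bigcup_n U_n$; otherwise II wins. - $FO(X)$ (finite-open game): I plays a finite set $F_n\subseteq X$, II plays an open set $U_n\supseteq F_n$. I wins if $X=\bigcup_n U_n$; otherwise II wins. - $\Omega FO(X)$: same moves as $FO(X)$, but I wins if $\{U_n:n<\omega\}$ is an $\omega$-cover of $X$; otherwise II wins. - Gruenhage's $W$-game on $Y$ at $y$: I plays an open set $U_n\ni y$, II plays a point $y_n\in U_n$. I wins if $y_n\to y$; otherwise II wins. - Gruenhage's clustering game on $Y$ at $y$: same moves as the $W$-game, but I wins if $y$ is a cluster point of the sequence $(y_n)_{n<\omega}$, i.e. every neighborhood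 of $y$ contains $y_n$ for infinitely many $n$; otherwise II wins. - $CL(Y,y)$: I plays a nonempty open set $U_n\subseteq Y$, II plays a point $y_n\in U_n$. I wins if $y\in\overline{\{y_n:n<\omega\}}$; otherwise II wins. - $CD(Y)$: same moves as $CL(Y,y)$, but II wins if $\{y_n:n<\omega\}$ is closed and discrete in $Y$; otherwise I wins. Strategies. A strategy for a player decides each move as a function of all previous moves of the opponent (perfect information). It is winning if the player using it wins against every legal sequence of moves of the opponent. *)

theory Defs
  imports "HOL-Analysis.Analysis"
begin

section \<open>Function spaces and families of sets\<close>

text \<open>Functions on \<open>topspace X\<close> are represented by extensional functions
  (with value \<^const>\<open>undefined\<close> off \<open>topspace X\<close>), as in \<^const>\<open>product_topology\<close>.\<close>

definition Cp :: "'a topology \<Rightarrow> ('a \<Rightarrow> real) topology" where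
  "Cp X = subtopology (product_topology (\<lambda>_. euclideanreal) (topspace X))
            {f. continuous_map X euclideanreal f}"

definition Cp_zero :: "'a topology \<Rightarrow> 'a \<Rightarrow> real" where
  "Cp_zero X = (\<lambda>x\<in>topspace X. 0)"

lemma topspace_Cp:
  "topspace (Cp X) = {f \<in> extensional (topspace X). continuous_map X euclideanreal f}"
  by (auto simp: Cp_def topspace_subtopology PiE_def)

lemma Cp_zero_in_topspace: "Cp_zero X \<in> topspace (Cp X)"
proof -
  have "continuous_map X euclideanreal (Cp_zero X)"
    by (rule continuous_map_eq[of _ _ "\<lambda>_. 0"]) (auto simp: Cp_zero_def)
  then show ?thesis by (auto simp: topspace_Cp Cp_zero_def)
qed

definition open_covers :: "'a topology \<Rightarrow> 'a set set set" where
  "open_covers X = {\<U>. (\<forall>U\<in>\<U>. openin X U) \<and> \<Union>\<U> = topspace X}"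

text \<open>The whole space is allowed as a member of an \<open>\<omega>\<close>-cover.\<close>

definition omega_covers :: "'a topology \<Rightarrow> 'a set set set" where
  "omega_covers X =
     {\<U> \<in> open_covers X. \<forall>F. finite F \<and> F \<subseteq> topspace X \<longrightarrow> (\<exists>U\<in>\<U>. F \<subseteq> U)}"

definition clustering_sets :: "'a topology \<Rightarrow> 'a \<Rightarrow> 'a set set" where
  "clustering_sets Y y = {A. A \<subseteq> topspace Y \<and> y \<in> Y closure_of A}"

definition dense_sets :: "'a topology \<Rightarrow> 'a set set" where
  "dense_sets Y = {D. D \<subseteq> topspace Y \<and> Y closure_of D = topspace Y}"

definition closed_discrete :: "'a topology \<Rightarrow> 'a set \<Rightarrow> bool" where
  "closed_discrete Y A \<longleftrightarrow> closedin Y A \<and> subtopology Y A = discrete_topology A"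

section \<open>Games of length \<open>\<omega>\<close> and strategies\<close>

text \<open>In each round player I makes a move \<open>a \<in> moves_I G\<close> and player II answers with
  some \<open>b \<in> moves_II G a\<close>; \<open>wins_I G a b\<close> says that I wins the play with moves
  \<open>a 0, b 0, a 1, b 1, \<dots>\<close>, and otherwise II wins.\<close>

record ('a, 'b) game =
  moves_I :: "'a set"
  moves_II :: "'a \<Rightarrow> 'b set"
  wins_I :: "(nat \<Rightarrow> 'a) \<Rightarrow> (nat \<Rightarrow> 'b) \<Rightarrow> bool"

text \<open>A strategy maps the list of the opponent's moves so far to the next move.\<close>

definition play_I :: "('b list \<Rightarrow> 'a) \<Rightarrow> (nat \<Rightarrow> 'b) \<Rightarrow> nat \<Rightarrow> 'a" where
  "play_I \<sigma> b n = \<sigma> (map b [0..<n])"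

definition play_II :: "('a list \<Rightarrow> 'b) \<Rightarrow> (nat \<Rightarrow> 'a) \<Rightarrow> nat \<Rightarrow> 'b" where
  "play_II \<tau> a n = \<tau> (map a [0..<Suc n])"

text \<open>A winning strategy must also make legal moves. This is demanded after every finite
  legal history, so that a player cannot win vacuously by an illegal move (such as the
  empty open set) to which the opponent has no legal answer.\<close>

definition winning_strategy_I :: "('a, 'b) game \<Rightarrow> ('b list \<Rightarrow> 'a) \<Rightarrow> bool" where
  "winning_strategy_I G \<sigma> \<longleftrightarrow>
     (\<forall>b. (\<forall>n. (\<forall>i<n. b i \<in> moves_II G (play_I \<sigma> b i)) \<longrightarrow> play_I \<sigma> b n \<in> moves_I G) \<and>
          ((\<forall>n. b n \<in> moves_II G (play_I \<sigma> b n)) \<longrightarrow> wins_I G (play_I \<sigma> b) b))"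

definition winning_strategy_II :: "('a, 'b) game \<Rightarrow> ('a list \<Rightarrow> 'b) \<Rightarrow> bool" where
  "winning_strategy_II G \<tau> \<longleftrightarrow>
     (\<forall>a. (\<forall>n. (\<forall>i\<le>n. a i \<in> moves_I G) \<longrightarrow> play_II \<tau> a n \<in> moves_II G (a n)) \<and>
          ((\<forall>n. a n \<in> moves_I G) \<longrightarrow> \<not> wins_I G a (play_II \<tau> a)))"

definition I_has_winning_strategy :: "('a, 'b) game \<Rightarrow> bool" where
  "I_has_winning_strategy G \<longleftrightarrow> (\<exists>\<sigma>. winning_strategy_I G \<sigma>)"

definition II_has_winning_strategy :: "('a, 'b) game \<Rightarrow> bool" where
  "II_has_winning_strategy G \<longleftrightarrow> (\<exists>\<tau>. winning_strategy_II G \<tau>)"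

section \<open>The games\<close>

definition G1 :: "'a set set \<Rightarrow> 'a set set \<Rightarrow> ('a set, 'a) game" where
  "G1 \<A> \<B> = \<lparr>moves_I = \<A>, moves_II = (\<lambda>A. A), wins_I = (\<lambda>A b. range b \<notin> \<B>)\<rparr>"

definition point_open_game :: "'a topology \<Rightarrow> ('a, 'a set) game" where
  "point_open_game X =
     \<lparr>moves_I = topspace X,
      moves_II = (\<lambda>x. {U. openin X U \<and> x \<in> U}),
      wins_I = (\<lambda>x U. topspace X = (\<Union>n. U n))\<rparr>"

definition finite_open_game :: "'a topology \<Rightarrow> ('a set, 'a set) game" where
  "finite_open_game X =
     \<lparr>moves_I = {F. finite F \<and> F \<subseteq> topspace X},
      moves_II = (\<lambda>F. {U. openin X U \<and> F \<subseteq> U}),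
      wins_I = (\<lambda>F U. topspace X = (\<Union>n. U n))\<rparr>"

definition omega_finite_open_game :: "'a topology \<Rightarrow> ('a set, 'a set) game" where
  "omega_finite_open_game X =
     \<lparr>moves_I = {F. finite F \<and> F \<subseteq> topspace X},
      moves_II = (\<lambda>F. {U. openin X U \<and> F \<subseteq> U}),
      wins_I = (\<lambda>F U. range U \<in> omega_covers X)\<rparr>"

definition W_game :: "'a topology \<Rightarrow> 'a \<Rightarrow> ('a set, 'a) game" where
  "W_game Y y =
     \<lparr>moves_I = {U. openin Y U \<and> y \<in> U},
      moves_II = (\<lambda>U. U),
      wins_I = (\<lambda>U s. limitin Y s y sequentially)\<rparr>"

definition clustering_game :: "'a topology \<Rightarrow> 'a \<Rightarrow> ('a set, 'a) game" where
  "clustering_game Y y =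
     \<lparr>moves_I = {U. openin Y U \<and> y \<in> U},
      moves_II = (\<lambda>U. U),
      wins_I = (\<lambda>U s. \<forall>V. openin Y V \<and> y \<in> V \<longrightarrow> infinite {n. s n \<in> V})\<rparr>"

definition CL_game :: "'a topology \<Rightarrow> 'a \<Rightarrow> ('a set, 'a) game" where
  "CL_game Y y =
     \<lparr>moves_I = {U. openin Y U \<and> U \<noteq> {}},
      moves_II = (\<lambda>U. U),
      wins_I = (\<lambda>U s. y \<in> Y closure_of (range s))\<rparr>"

definition CD_game :: "'a topology \<Rightarrow> ('a set, 'a) game" where
  "CD_game Y =
     \<lparr>moves_I = {U. openin Y U \<and> U \<noteq> {}},
      moves_II = (\<lambda>U. U),
      wins_I = (\<lambda>U s. \<not> closed_discrete Y (range s))\<rparr>"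

end

theory Submission
  imports Defs "HOL-Library.Sublist"
begin

text \<open>All the games are shown equivalent to the finite-open game for player I.

  The selection games won by player II reduce to games won by player I through Galvin's
  duality, proved once for arbitrary games in \<open>II_wins_G1_imp_I_wins_dual\<close> and
  \<open>I_wins_dual_imp_II_wins_G1\<close>: after any history of a winning strategy of II, some move of I
  in the dual game has the property that every reply to it is the answer of the strategy to
  some legal move. This matches open covers with the point-open game, \<open>\<omega>\<close>-covers with the
  \<open>\<omega>\<close>-version of the finite-open game, and dense sets of functions with the game \<open>CL\<close>.

  Two facts connect the covering games. A finite move can be replaced by a block of point moves
  (\<open>finite_open_imp_point_open\<close>). And player I can follow the winning strategy along all
  subsequences of the play simultaneously (\<open>finite_open_imp_eventual_finite_open\<close>); as each
  subsequence must then cover the space, every point lies in all but finitely many of II's sets.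

  The stronger form of the game gives the \<open>\<omega>\<close>-version, and it turns a set \<open>F\<close> into the
  neighbourhood of functions small on \<open>F\<close>, which gives convergence in the \<open>W\<close>-game
  (\<open>eventual_finite_open_imp_W\<close>). Convergence implies clustering, which implies \<open>CL\<close>, and by
  avoiding the zero function \<open>CL\<close> implies \<open>CD\<close>. The cycle closes in \<open>CD_imp_finite_open\<close>: an open
  set of functions restricts them at finitely many points only, so on the complement of II's
  open set in round \<open>n\<close> a function can be made constantly \<open>n\<close>, and a point never covered would
  make these functions a closed discrete set. Finally, the selection game on sets clustering at
  zero lies between the clustering game and the selection game on dense sets.\<close>

section \<open>Strategies\<close>

text \<open>A winning strategy may be changed at histories that never arise against a legal opponent,
  so it may be assumed to move legally after every list whatsoever. This removes all legality
  side conditions on histories from the translations of strategies below.\<close>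

lemma I_has_winning_strategy_iff:
  "I_has_winning_strategy G \<longleftrightarrow>
     (\<exists>\<sigma>. (\<forall>bs. \<sigma> bs \<in> moves_I G) \<and>
          (\<forall>b. (\<forall>n. b n \<in> moves_II G (play_I \<sigma> b n)) \<longrightarrow> wins_I G (play_I \<sigma> b) b))"
proof
  assume "I_has_winning_strategy G"
  then obtain \<sigma> where \<sigma>: "winning_strategy_I G \<sigma>"
    by (auto simp: I_has_winning_strategy_def)
  have legal: "play_I \<sigma> b n \<in> moves_I G" if "\<forall>i<n. b i \<in> moves_II G (play_I \<sigma> b i)" for b n
    using \<sigma> that by (auto simp: winning_strategy_I_def)
  have first: "\<sigma> [] \<in> moves_I G"
    using legal[of 0] by (simp add: play_I_def)
  define \<sigma>' where "\<sigma>' bs = (if \<sigma> bs \<in> moves_I G then \<sigma> bs else \<sigma> [])" for bs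
  have "wins_I G (play_I \<sigma>' b) b" if b: "\<forall>n. b n \<in> moves_II G (play_I \<sigma>' b n)" for b
  proof -
    have eq: "play_I \<sigma>' b n = play_I \<sigma> b n" for n
    proof (induction n rule: less_induct)
      case (less n)
      then have "play_I \<sigma> b n \<in> moves_I G"
        using b by (intro legal) metis
      then show ?case by (simp add: play_I_def \<sigma>'_def)
    qed
    then have "play_I \<sigma>' b = play_I \<sigma> b" by auto
    with \<sigma> b show ?thesis by (auto simp: winning_strategy_I_def)
  qed
  moreover have "\<sigma>' bs \<in> moves_I G" for bs
    using first by (simp add: \<sigma>'_def)
  ultimately show "\<exists>\<sigma>. (\<forall>bs. \<sigma> bs \<in> moves_I G) \<and>
      (\<forall>b. (\<forall>n. b n \<in> moves_II G (play_I \<sigma> b n)) \<longrightarrow> wins_I G (play_I \<sigma> b) b)"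
    by blast
next
  assume "\<exists>\<sigma>. (\<forall>bs. \<sigma> bs \<in> moves_I G) \<and>
      (\<forall>b. (\<forall>n. b n \<in> moves_II G (play_I \<sigma> b n)) \<longrightarrow> wins_I G (play_I \<sigma> b) b)"
  then obtain \<sigma> where "\<forall>bs. \<sigma> bs \<in> moves_I G"
    "\<forall>b. (\<forall>n. b n \<in> moves_II G (play_I \<sigma> b n)) \<longrightarrow> wins_I G (play_I \<sigma> b) b"
    by blast
  then have "winning_strategy_I G \<sigma>"
    by (simp add: winning_strategy_I_def play_I_def)
  then show "I_has_winning_strategy G"
    unfolding I_has_winning_strategy_def by blast
qed

lemma II_has_winning_strategy_iff:
  "II_has_winning_strategy G \<longleftrightarrow>
     (\<exists>\<tau>. (\<forall>as. \<forall>a\<in>moves_I G. \<tau> (as @ [a]) \<in> moves_II G a) \<and>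
          (\<forall>a. (\<forall>n. a n \<in> moves_I G) \<longrightarrow> \<not> wins_I G a (play_II \<tau> a)))"
proof
  assume "II_has_winning_strategy G"
  then obtain \<tau> where \<tau>: "winning_strategy_II G \<tau>"
    by (auto simp: II_has_winning_strategy_def)
  have legal: "play_II \<tau> a n \<in> moves_II G (a n)" if "\<forall>i\<le>n. a i \<in> moves_I G" for a n
    using \<tau> that by (auto simp: winning_strategy_II_def)
  have first: "\<tau> [x] \<in> moves_II G x" if "x \<in> moves_I G" for x
    using legal[of 0 "\<lambda>_. x"] that by (simp add: play_II_def)
  define \<tau>' where
    "\<tau>' as = (if \<tau> as \<in> moves_II G (last as) then \<tau> as else \<tau> [last as])" for as
  have "\<not> wins_I G a (play_II \<tau>' a)" if a: "\<forall>n. a n \<in> moves_I G" for a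
  proof -
    have "play_II \<tau>' a n = play_II \<tau> a n" for n
      using legal[of n a] a by (simp add: play_II_def \<tau>'_def)
    then have "play_II \<tau>' a = play_II \<tau> a" by auto
    with \<tau> a show ?thesis by (auto simp: winning_strategy_II_def)
  qed
  moreover have "\<tau>' (as @ [x]) \<in> moves_II G x" if "x \<in> moves_I G" for as x
    using first that by (simp add: \<tau>'_def)
  ultimately show "\<exists>\<tau>. (\<forall>as. \<forall>a\<in>moves_I G. \<tau> (as @ [a]) \<in> moves_II G a) \<and>
      (\<forall>a. (\<forall>n. a n \<in> moves_I G) \<longrightarrow> \<not> wins_I G a (play_II \<tau> a))"
    by blast
next
  assume "\<exists>\<tau>. (\<forall>as. \<forall>a\<in>moves_I G. \<tau> (as @ [a]) \<in> moves_II G a) \<and>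
      (\<forall>a. (\<forall>n. a n \<in> moves_I G) \<longrightarrow> \<not> wins_I G a (play_II \<tau> a))"
  then obtain \<tau> where "\<forall>as. \<forall>a\<in>moves_I G. \<tau> (as @ [a]) \<in> moves_II G a"
    "\<forall>a. (\<forall>n. a n \<in> moves_I G) \<longrightarrow> \<not> wins_I G a (play_II \<tau> a)"
    by blast
  then have "winning_strategy_II G \<tau>"
    by (simp add: winning_strategy_II_def play_II_def)
  then show "II_has_winning_strategy G"
    unfolding II_has_winning_strategy_def by blast
qed

text \<open>All translations of strategies work online: while the moves \<open>c 0, c 1, \<dots>\<close> of a real game
  arrive, they are converted one by one into moves \<open>d 0, d 1, \<dots>\<close> of an imagined game, where
  each conversion may look at the imagined history.\<close>

definition responses :: "('d list \<Rightarrow> 'c \<Rightarrow> 'd) \<Rightarrow> 'c list \<Rightarrow> 'd list" where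
  "responses g cs = foldl (\<lambda>ds c. ds @ [g ds c]) [] cs"

lemma responses_along_sequence:
  obtains d where "\<And>n. responses g (map c [0..<n]) = map d [0..<n]"
    and "\<And>n. d n = g (map d [0..<n]) (c n)"
proof -
  define d where "d n = g (responses g (map c [0..<n])) (c n)" for n
  have "responses g (map c [0..<n]) = map d [0..<n]" for n
    by (induction n) (simp_all add: responses_def d_def)
  then show thesis by (intro that[of d]) (simp_all add: d_def)
qed

text \<open>Player I wins \<open>G'\<close> by playing \<open>G\<close> on the side: each move that the strategy for \<open>G\<close>
  proposes in round \<open>n\<close> is turned by \<open>mv n\<close> into a move of \<open>G'\<close>, and the answer received
  there is turned by \<open>rp n\<close> into an answer in \<open>G\<close>.\<close>

lemma I_wins_by_simulation:
  assumes "I_has_winning_strategy G"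
    and move: "\<And>n a. a \<in> moves_I G \<Longrightarrow> mv n a \<in> moves_I G'"
    and reply: "\<And>n a c. \<lbrakk>a \<in> moves_I G; c \<in> moves_II G' (mv n a)\<rbrakk> \<Longrightarrow> rp n a c \<in> moves_II G a"
    and win: "\<And>a c. \<lbrakk>\<And>n. a n \<in> moves_I G; \<And>n. c n \<in> moves_II G' (mv n (a n));
        wins_I G a (\<lambda>n. rp n (a n) (c n))\<rbrakk> \<Longrightarrow> wins_I G' (\<lambda>n. mv n (a n)) c"
  shows "I_has_winning_strategy G'"
proof -
  obtain \<sigma> where legal: "\<And>bs. \<sigma> bs \<in> moves_I G"
    and wins: "\<And>b. (\<And>n. b n \<in> moves_II G (play_I \<sigma> b n)) \<Longrightarrow> wins_I G (play_I \<sigma> b) b"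
    using assms(1) unfolding I_has_winning_strategy_iff by blast
  define g where "g ds c = rp (length ds) (\<sigma> ds) c" for ds c
  define \<sigma>' where "\<sigma>' cs = mv (length cs) (\<sigma> (responses g cs))" for cs
  have "wins_I G' (play_I \<sigma>' c) c" if c: "\<forall>n. c n \<in> moves_II G' (play_I \<sigma>' c n)" for c
  proof -
    obtain d where d: "\<And>n. responses g (map c [0..<n]) = map d [0..<n]"
      "\<And>n. d n = g (map d [0..<n]) (c n)"
      by (rule responses_along_sequence[of g c]) (rule that)
    have play: "play_I \<sigma>' c = (\<lambda>n. mv n (play_I \<sigma> d n))"
      by (simp add: fun_eq_iff play_I_def \<sigma>'_def d(1))
    have d_eq: "d = (\<lambda>n. rp n (play_I \<sigma> d n) (c n))"
      by (simp add: fun_eq_iff play_I_def d(2) g_def)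
    have c': "c n \<in> moves_II G' (mv n (play_I \<sigma> d n))" for n
      using c play by simp
    have a: "play_I \<sigma> d n \<in> moves_I G" for n
      by (simp add: play_I_def legal)
    have "d n \<in> moves_II G (play_I \<sigma> d n)" for n
      by (subst fun_cong[OF d_eq]) (rule reply[OF a c'])
    then have "wins_I G (play_I \<sigma> d) d" by (rule wins)
    then show ?thesis
      unfolding play by (intro win a c') (simp flip: d_eq)
  qed
  moreover have "\<sigma>' cs \<in> moves_I G'" for cs
    unfolding \<sigma>'_def by (intro move legal)
  ultimately show ?thesis
    unfolding I_has_winning_strategy_iff by (intro exI[of _ \<sigma>']) simp
qed

section \<open>Galvin duality for selection games\<close>

text \<open>Galvin's argument. After any history of a winning strategy \<open>\<tau>\<close> of II, player I has a
  move \<open>m\<close> in \<open>H\<close> such that every legal reply to \<open>m\<close> is the answer of \<open>\<tau>\<close> to some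
  member of \<open>\<A>\<close>. Otherwise each \<open>m\<close> would have a reply that \<open>\<tau>\<close> never gives, and these
  replies together would form a member of \<open>\<A>\<close> to which \<open>\<tau>\<close> has no answer. Playing such
  moves, player I makes II's replies in \<open>H\<close> coincide with a play of \<open>\<tau>\<close>.\<close>

lemma II_wins_G1_imp_I_wins_dual:
  assumes "II_has_winning_strategy (G1 \<A> \<B>)"
    and selector: "\<And>f. (\<And>m. m \<in> moves_I H \<Longrightarrow> f m \<in> moves_II H m) \<Longrightarrow> f ` moves_I H \<in> \<A>"
    and win: "\<And>m b. \<lbrakk>\<And>n. b n \<in> moves_II H (m n); range b \<in> \<B>\<rbrakk> \<Longrightarrow> wins_I H m b"
  shows "I_has_winning_strategy H"
proof -
  obtain \<tau> where legal: "\<And>As A. A \<in> \<A> \<Longrightarrow> \<tau> (As @ [A]) \<in> A"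
    and wins: "\<And>A. (\<And>n. A n \<in> \<A>) \<Longrightarrow> range (play_II \<tau> A) \<in> \<B>"
    using assms(1) unfolding II_has_winning_strategy_iff by (auto simp: G1_def)
  have "\<exists>m\<in>moves_I H. \<forall>b\<in>moves_II H m. \<exists>A\<in>\<A>. \<tau> (As @ [A]) = b" for As
  proof (rule ccontr)
    assume "\<not> ?thesis"
    then have "\<forall>m\<in>moves_I H. \<exists>b. b \<in> moves_II H m \<and> (\<forall>A\<in>\<A>. \<tau> (As @ [A]) \<noteq> b)"
      by blast
    from bchoice[OF this] obtain f where f: "\<And>m. m \<in> moves_I H \<Longrightarrow> f m \<in> moves_II H m"
        "\<And>m A. \<lbrakk>m \<in> moves_I H; A \<in> \<A>\<rbrakk> \<Longrightarrow> \<tau> (As @ [A]) \<noteq> f m"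
      by blast
    have "f ` moves_I H \<in> \<A>" by (intro selector f(1))
    with legal[OF this, of As] f(2) show False by blast
  qed
  then have "\<forall>As. \<exists>m. m \<in> moves_I H \<and> (\<forall>b\<in>moves_II H m. \<exists>A\<in>\<A>. \<tau> (As @ [A]) = b)"
    by blast
  from choice[OF this] obtain mv where mv: "\<And>As. mv As \<in> moves_I H"
    and ex: "\<And>As b. b \<in> moves_II H (mv As) \<Longrightarrow> \<exists>A. A \<in> \<A> \<and> \<tau> (As @ [A]) = b"
    by blast
  define ans where "ans As b = (SOME A. A \<in> \<A> \<and> \<tau> (As @ [A]) = b)" for As b
  have ans: "ans As b \<in> \<A> \<and> \<tau> (As @ [ans As b]) = b" if "b \<in> moves_II H (mv As)" for As b
    unfolding ans_def by (rule someI_ex[OF ex[OF that]])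
  have "wins_I H (play_I (\<lambda>bs. mv (responses ans bs)) b) b"
    if b: "\<forall>n. b n \<in> moves_II H (play_I (\<lambda>bs. mv (responses ans bs)) b n)" for b
  proof -
    obtain A where A: "\<And>n. responses ans (map b [0..<n]) = map A [0..<n]"
      "\<And>n. A n = ans (map A [0..<n]) (b n)"
      by (rule responses_along_sequence[of ans b]) (rule that)
    have "A n \<in> \<A> \<and> \<tau> (map A [0..<n] @ [A n]) = b n" for n
    proof -
      have "b n \<in> moves_II H (mv (map A [0..<n]))"
        using b A(1) by (simp add: play_I_def)
      from ans[OF this] show ?thesis by (simp flip: A(2))
    qed
    then have "\<And>n. A n \<in> \<A>" and "play_II \<tau> A = b"
      by (auto simp: play_II_def fun_eq_iff)
    with wins[of A] have "range b \<in> \<B>" by simp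
    with b show ?thesis by (intro win) auto
  qed
  with mv show ?thesis
    unfolding I_has_winning_strategy_iff
    by (intro exI[of _ "\<lambda>bs. mv (responses ans bs)"]) simp
qed

text \<open>Player II imagines a play of \<open>H\<close> against the winning strategy there, and chooses from each
  set offered a point that is also a legal reply to the current move of that strategy.\<close>

lemma I_wins_dual_imp_II_wins_G1:
  assumes "I_has_winning_strategy H"
    and meet: "\<And>m A. \<lbrakk>m \<in> moves_I H; A \<in> \<A>\<rbrakk> \<Longrightarrow> A \<inter> moves_II H m \<noteq> {}"
    and win: "\<And>m b. \<lbrakk>\<And>n. m n \<in> moves_I H; \<And>n. b n \<in> moves_II H (m n); wins_I H m b\<rbrakk>
                \<Longrightarrow> range b \<in> \<B>"
  shows "II_has_winning_strategy (G1 \<A> \<B>)"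
proof -
  obtain \<sigma> where legal: "\<And>bs. \<sigma> bs \<in> moves_I H"
    and wins: "\<And>b. (\<And>n. b n \<in> moves_II H (play_I \<sigma> b n)) \<Longrightarrow> wins_I H (play_I \<sigma> b) b"
    using assms(1) unfolding I_has_winning_strategy_iff by blast
  define pick where "pick bs A = (SOME b. b \<in> A \<inter> moves_II H (\<sigma> bs))" for bs A
  have pick: "pick bs A \<in> A \<inter> moves_II H (\<sigma> bs)" if "A \<in> \<A>" for bs A
    unfolding pick_def some_in_eq by (rule meet[OF legal that])
  define \<tau> where "\<tau> As = last (responses pick As)" for As
  have \<tau>_snoc: "\<tau> (As @ [A]) = pick (responses pick As) A" for As A
    by (simp add: \<tau>_def responses_def)
  have "range (play_II \<tau> A) \<in> \<B>" if A: "\<forall>n. A n \<in> \<A>" for A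
  proof -
    obtain b where b: "\<And>n. responses pick (map A [0..<n]) = map b [0..<n]"
      "\<And>n. b n = pick (map b [0..<n]) (A n)"
      by (rule responses_along_sequence[of pick A]) (rule that)
    have "play_II \<tau> A n = b n" for n
      by (subst b(2)) (simp add: play_II_def \<tau>_snoc b(1))
    then have eq: "play_II \<tau> A = b" by (rule ext)
    have "b n \<in> A n \<inter> moves_II H (play_I \<sigma> b n)" for n
      unfolding play_I_def by (subst b(2)) (rule pick[OF A[THEN spec]])
    then have bII: "b n \<in> moves_II H (play_I \<sigma> b n)" for n by blast
    have "play_I \<sigma> b n \<in> moves_I H" for n
      unfolding play_I_def by (rule legal)
    then have "range b \<in> \<B>"
      by (rule win[OF _ bII wins[OF bII]])
    then show ?thesis by (simp only: eq)
  qed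
  moreover have "\<tau> (As @ [A]) \<in> A" if "A \<in> \<A>" for As A
    using pick[OF that] by (simp add: \<tau>_snoc)
  ultimately have "(\<forall>As. \<forall>A\<in>\<A>. \<tau> (As @ [A]) \<in> A) \<and>
      (\<forall>A. (\<forall>n. A n \<in> \<A>) \<longrightarrow> range (play_II \<tau> A) \<in> \<B>)"
    by blast
  then show ?thesis
    unfolding II_has_winning_strategy_iff by (intro exI[of _ \<tau>]) (simp add: G1_def)
qed

lemma II_wins_G1_antimono:
  assumes "II_has_winning_strategy (G1 \<A> \<B>)" and "\<A>' \<subseteq> \<A>"
  shows "II_has_winning_strategy (G1 \<A>' \<B>)"
proof -
  obtain \<tau> where "\<forall>As. \<forall>A\<in>\<A>. \<tau> (As @ [A]) \<in> A"
    and "\<forall>A. (\<forall>n. A n \<in> \<A>) \<longrightarrow> range (play_II \<tau> A) \<in> \<B>"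
    using assms(1) unfolding II_has_winning_strategy_iff by (auto simp: G1_def)
  with assms(2) show ?thesis
    unfolding II_has_winning_strategy_iff
    by (intro exI[of _ \<tau>]) (auto simp: G1_def subset_iff)
qed

section \<open>Finite-open and point-open games\<close>

text \<open>In this variant of the finite-open game player I must capture each point in all but
  finitely many of II's sets. It is no harder to win than the finite-open game, and it yields
  both \<open>\<omega>\<close>-covers and convergence in function spaces.\<close>

definition eventual_finite_open_game :: "'a topology \<Rightarrow> ('a set, 'a set) game" where
  "eventual_finite_open_game X =
     \<lparr>moves_I = {F. finite F \<and> F \<subseteq> topspace X},
      moves_II = (\<lambda>F. {U. openin X U \<and> F \<subseteq> U}),
      wins_I = (\<lambda>F U. \<forall>x\<in>topspace X. \<forall>\<^sub>F n in sequentially. x \<in> U n)\<rparr>"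

lemma subseq_map_strict_mono:
  assumes "strict_mono r"
  shows "subseq (map (\<lambda>i. b (r i)) [0..<k]) (map b [0..<r k])"
proof (induction k)
  case (Suc k)
  have "r k < r (Suc k)"
    using assms by (simp add: strict_mono_def)
  then have "[0..<r (Suc k)] = [0..<r k] @ r k # [Suc (r k)..<r (Suc k)]"
    using upt_add_eq_append[of 0 "r k" "r (Suc k) - r k"] by (simp add: upt_conv_Cons)
  then have "map b [0..<r (Suc k)] = map b [0..<r k] @ ([b (r k)] @ map b [Suc (r k)..<r (Suc k)])"
    by simp
  moreover have "subseq ([b (r k)] @ []) ([b (r k)] @ map b [Suc (r k)..<r (Suc k)])"
    by simp
  ultimately show ?case
    using list_emb_append_mono[OF Suc.IH] by simp
qed simp

text \<open>Player I plays at once all the finite sets that the given strategy would play after any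
  subsequence of the sets seen so far. Then every infinite subsequence of II's replies is a
  legal play against the given strategy, and hence covers the space. So no point can be
  missed infinitely often.\<close>

lemma finite_open_imp_eventual_finite_open:
  assumes "I_has_winning_strategy (finite_open_game X)"
  shows "I_has_winning_strategy (eventual_finite_open_game X)"
proof -
  obtain \<sigma> where fin: "\<And>bs. finite (\<sigma> bs) \<and> \<sigma> bs \<subseteq> topspace X"
    and wins: "\<And>U. (\<And>n. openin X (U n) \<and> play_I \<sigma> U n \<subseteq> U n) \<Longrightarrow> topspace X = (\<Union>n. U n)"
    using assms unfolding I_has_winning_strategy_iff by (auto simp: finite_open_game_def)
  define \<sigma>' where "\<sigma>' bs = (\<Union>s\<in>set (subseqs bs). \<sigma> s)" for bs
  have "\<forall>\<^sub>F n in sequentially. x \<in> U n"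
    if U: "\<forall>n. openin X (U n) \<and> play_I \<sigma>' U n \<subseteq> U n" and x: "x \<in> topspace X" for U x
  proof (rule ccontr)
    assume "\<not> ?thesis"
    then have "infinite {n. x \<notin> U n}"
      unfolding cofinite_eq_sequentially[symmetric] eventually_cofinite by simp
    then obtain r :: "nat \<Rightarrow> nat" where r: "strict_mono r" "\<And>k. r k \<in> {n. x \<notin> U n}"
      using infinite_enumerate by blast
    have "play_I \<sigma> (\<lambda>i. U (r i)) k \<subseteq> U (r k)" for k
    proof -
      have "map (\<lambda>i. U (r i)) [0..<k] \<in> set (subseqs (map U [0..<r k]))"
        using subseq_map_strict_mono[OF r(1)] by (simp add: set_subseqs_eq)
      then have "play_I \<sigma> (\<lambda>i. U (r i)) k \<subseteq> play_I \<sigma>' U (r k)"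
        unfolding play_I_def \<sigma>'_def by blast
      with U show ?thesis by blast
    qed
    then have "topspace X = (\<Union>k. U (r k))"
      using U by (intro wins) simp
    with x r(2) show False by blast
  qed
  moreover have "finite (\<sigma>' bs) \<and> \<sigma>' bs \<subseteq> topspace X" for bs
    using fin by (auto simp: \<sigma>'_def)
  ultimately show ?thesis
    unfolding I_has_winning_strategy_iff
    by (intro exI[of _ \<sigma>']) (simp add: eventual_finite_open_game_def)
qed

text \<open>A finite move in the finite-open game is replaced by a block of point moves, and the union of
  the replies within the block serves as the reply to the finite set. Here \<open>pts Us\<close> lists
  the finite set to be played after the history \<open>Us\<close> of completed blocks, and \<open>bs\<close> are
  the replies not yet assigned to a completed block. Each block starts with a spare point
  \<open>x0\<close>, so that it is nonempty even when the finite set is empty.\<close>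

function block_move :: "'a \<Rightarrow> ('a set list \<Rightarrow> 'a list) \<Rightarrow> 'a set list \<Rightarrow> 'a set list \<Rightarrow> 'a" where
  "block_move x0 pts Us bs =
     (if length bs \<le> length (pts Us) then (x0 # pts Us) ! length bs
      else block_move x0 pts (Us @ [\<Union>(set (take (Suc (length (pts Us))) bs))])
             (drop (Suc (length (pts Us))) bs))"
  by auto
termination by (relation "Wellfounded.measure (\<lambda>(x0, pts, Us, bs). length bs)") auto

declare block_move.simps [simp del]

lemma finite_open_imp_point_open:
  assumes "topspace X \<noteq> {}" and "I_has_winning_strategy (finite_open_game X)"
  shows "I_has_winning_strategy (point_open_game X)"
proof -
  obtain \<sigma> where fin: "\<And>bs. finite (\<sigma> bs) \<and> \<sigma> bs \<subseteq> topspace X"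
    and wins: "\<And>U. (\<And>n. openin X (U n) \<and> play_I \<sigma> U n \<subseteq> U n) \<Longrightarrow> topspace X = (\<Union>n. U n)"
    using assms(2) unfolding I_has_winning_strategy_iff by (auto simp: finite_open_game_def)
  obtain x0 where x0: "x0 \<in> topspace X" using assms(1) by blast
  define pts where "pts Us = (SOME ps. set ps = \<sigma> Us)" for Us
  have pts: "set (pts Us) = \<sigma> Us" for Us
    unfolding pts_def by (rule someI_ex) (simp add: finite_list fin)
  define \<phi> where "\<phi> = block_move x0 pts []"
  have move: "block_move x0 pts Us bs \<in> topspace X" for Us bs
  proof (induction bs arbitrary: Us rule: length_induct)
    case (1 bs)
    show ?case
    proof (cases "length bs \<le> length (pts Us)")
      case True
      then have "(x0 # pts Us) ! length bs \<in> set (x0 # pts Us)"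
        by (intro nth_mem) simp
      also have "\<dots> \<subseteq> topspace X"
        using x0 fin pts by simp
      finally show ?thesis
        using True by (simp add: block_move.simps)
    next
      case False
      then show ?thesis
        using 1 by (subst block_move.simps) simp
    qed
  qed
  have "topspace X = (\<Union>n. b n)"
    if b: "\<forall>n. openin X (b n) \<and> play_I \<phi> b n \<in> b n" for b
  proof -
    \<comment> \<open>Block \<open>k\<close> occupies the rounds from \<open>t k\<close> up to but not including \<open>t (Suc k)\<close>; \<open>W k\<close> lists the unions
      of the blocks before it.\<close>
    define st where "st = rec_nat (0, []) (\<lambda>_ (t, W). (t + Suc (length (pts W)),
        W @ [\<Union>(b ` {t..<t + Suc (length (pts W))})]))"
    define t where "t k = fst (st k)" for k
    define W where "W k = snd (st k)" for k
    define U where "U k = \<Union>(b ` {t k..<t (Suc k)})" for k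
    have t_Suc: "t (Suc k) = t k + Suc (length (pts (W k)))" for k
      by (simp add: t_def W_def st_def split: prod.split)
    have W_Suc: "W (Suc k) = W k @ [U k]" for k
      unfolding U_def t_Suc by (simp add: t_def W_def st_def split: prod.split)
    have W_eq: "W k = map U [0..<k]" for k
      by (induction k) (simp_all add: W_Suc, simp add: W_def st_def)
    have run: "\<phi> (map b [0..<n]) = block_move x0 pts (W k) (map b [t k..<n])" if "t k \<le> n" for k n
      using that
    proof (induction k)
      case 0
      then show ?case by (simp add: \<phi>_def W_def t_def st_def)
    next
      case (Suc k)
      let ?l = "Suc (length (pts (W k)))"
      have n: "t k + ?l \<le> n" using Suc.prems by (simp add: t_Suc)
      have "take ?l (map b [t k..<n]) = map b [t k..<t k + ?l]"
        "drop ?l (map b [t k..<n]) = map b [t k + ?l..<n]"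
        using n by (simp_all add: take_map drop_map del: upt_Suc)
      moreover have "\<not> length (map b [t k..<n]) \<le> length (pts (W k))"
        using n by simp
      ultimately have "block_move x0 pts (W k) (map b [t k..<n]) =
          block_move x0 pts (W (Suc k)) (map b [t (Suc k)..<n])"
        by (subst block_move.simps) (simp only: if_False W_Suc U_def t_Suc set_map set_upt)
      with Suc show ?case by (simp add: t_Suc)
    qed
    have "\<sigma> (W k) \<subseteq> U k" for k
    proof
      fix x assume "x \<in> \<sigma> (W k)"
      then obtain j where j: "j < length (pts (W k))" "x = pts (W k) ! j"
        by (metis pts in_set_conv_nth)
      have "play_I \<phi> b (t k + Suc j) = x"
        unfolding play_I_def using j
        by (subst run[of k]) (simp_all add: block_move.simps del: upt_Suc)
      with b have "x \<in> b (t k + Suc j)" by metis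
      then show "x \<in> U k"
        unfolding U_def t_Suc using j by fastforce
    qed
    then have "play_I \<sigma> U k \<subseteq> U k" for k
      by (simp add: play_I_def W_eq)
    moreover have "openin X (U k)" for k
      using b by (auto simp: U_def)
    ultimately have "topspace X = (\<Union>k. U k)"
      by (intro wins) blast
    then have "topspace X \<subseteq> (\<Union>n. b n)"
      by (auto simp: U_def)
    moreover have "b n \<subseteq> topspace X" for n
      using b openin_subset by blast
    ultimately show ?thesis by blast
  qed
  with move show ?thesis
    unfolding I_has_winning_strategy_iff
    by (intro exI[of _ \<phi>]) (simp add: point_open_game_def \<phi>_def)
qed

section \<open>The space of continuous functions\<close>

lemma continuous_map_Cp_eval:
  "x \<in> topspace X \<Longrightarrow> continuous_map (Cp X) euclideanreal (\<lambda>g. g x)"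
  unfolding Cp_def
  by (intro continuous_map_from_subtopology continuous_map_product_projection)

lemma t1_space_Cp: "t1_space (Cp X)"
  unfolding Cp_def
  by (intro Hausdorff_imp_t1_space Hausdorff_space_subtopology)
     (simp add: Hausdorff_space_product_topology)

lemma limitin_Cp_zero:
  assumes "\<And>n. s n \<in> topspace (Cp X)"
  shows "limitin (Cp X) s (Cp_zero X) sequentially \<longleftrightarrow>
           (\<forall>x\<in>topspace X. (\<lambda>n. s n x) \<longlonglongrightarrow> 0)"
proof -
  have "s n \<in> extensional (topspace X)" "continuous_map X euclideanreal (s n)" for n
    using assms by (auto simp: topspace_Cp)
  moreover have "Cp_zero X \<in> extensional (topspace X)" "continuous_map X euclideanreal (Cp_zero X)"
    using Cp_zero_in_topspace[of X] by (auto simp: topspace_Cp)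
  ultimately show ?thesis
    unfolding Cp_def
    by (simp add: limitin_subtopology limitin_componentwise PiE_def Cp_zero_def)
qed

lemma Urysohn_finite_open:
  assumes "completely_regular_space X" and "finite F" and "openin X U" and "F \<subseteq> U"
  obtains h where "continuous_map X euclideanreal h" and "\<And>x. x \<in> F \<Longrightarrow> h x = 0"
    and "\<And>x. x \<in> topspace X - U \<Longrightarrow> h x = 1"
proof -
  have "\<forall>x\<in>F. \<exists>f. continuous_map X euclideanreal f \<and> f x = 0 \<and> f ` (topspace X - U) \<subseteq> {1}"
    using assms unfolding completely_regular_space_alt' by blast
  then obtain f where f: "\<And>x. x \<in> F \<Longrightarrow> continuous_map X euclideanreal (f x)"
    "\<And>x. x \<in> F \<Longrightarrow> f x x = 0" "\<And>x y. \<lbrakk>x \<in> F; y \<in> topspace X - U\<rbrakk> \<Longrightarrow> f x y = 1"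
    by (auto simp: image_subset_iff dest!: bchoice)
  show thesis
  proof
    show "continuous_map X euclideanreal (\<lambda>y. \<Prod>x\<in>F. f x y)"
      using assms(2) f(1) by (intro continuous_map_prod) auto
  qed (use assms(2) f in \<open>auto simp: prod_zero_iff\<close>)
qed

text \<open>A nonempty open subset of the function space restricts its members at finitely many points
  only. Away from an open neighbourhood of these points, the values can be prescribed freely.\<close>

lemma Cp_open_set_finite_support:
  assumes "completely_regular_space X" and "openin (Cp X) W" and "W \<noteq> {}"
  obtains F where "finite F" and "F \<subseteq> topspace X"
    and "\<And>U c. \<lbrakk>openin X U; F \<subseteq> U\<rbrakk> \<Longrightarrow> \<exists>g\<in>W. \<forall>x\<in>topspace X - U. g x = c"
proof -
  obtain f where "f \<in> W" using assms(3) by blast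
  obtain T where T: "openin (product_topology (\<lambda>_. euclideanreal) (topspace X)) T"
    and W: "W = T \<inter> {f. continuous_map X euclideanreal f}"
    using assms(2) unfolding Cp_def openin_subtopology by blast
  have f: "f \<in> T" "continuous_map X euclideanreal f"
    using W \<open>f \<in> W\<close> by auto
  obtain V where V: "finite {i \<in> topspace X. V i \<noteq> UNIV}" "f \<in> Pi\<^sub>E (topspace X) V"
    "Pi\<^sub>E (topspace X) V \<subseteq> T"
    using T f(1) unfolding openin_product_topology_alt by (metis topspace_euclidean)
  show thesis
  proof
    fix U :: "'a set" and c :: real
    assume U: "openin X U" "{i \<in> topspace X. V i \<noteq> UNIV} \<subseteq> U"
    obtain h where h: "continuous_map X euclideanreal h"
      "\<And>x. x \<in> {i \<in> topspace X. V i \<noteq> UNIV} \<Longrightarrow> h x = 0"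
      "\<And>x. x \<in> topspace X - U \<Longrightarrow> h x = 1"
      using Urysohn_finite_open[OF assms(1) V(1) U] by blast
    \<comment> \<open>Interpolate between \<open>f\<close>, where \<open>h\<close> vanishes, and the constant \<open>c\<close>, where \<open>h\<close> is \<open>1\<close>.\<close>
    define g where "g = (\<lambda>x\<in>topspace X. f x + h x * (c - f x))"
    have "g \<in> Pi\<^sub>E (topspace X) V"
    proof (rule PiE_I)
      fix x assume x: "x \<in> topspace X"
      show "g x \<in> V x"
      proof (cases "V x = UNIV")
        case False
        then have "g x = f x" using h(2) x by (simp add: g_def)
        then show ?thesis using V(2) x by auto
      qed simp
    qed (simp add: g_def)
    moreover have "continuous_map X euclideanreal g"
      by (rule continuous_map_eq[of _ _ "\<lambda>x. f x + h x * (c - f x)"])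
         (use f(2) h(1) in \<open>auto simp: g_def intro!: continuous_intros\<close>)
    ultimately have "g \<in> W" using V(3) W by blast
    moreover have "\<forall>x\<in>topspace X - U. g x = c"
      using h(3) by (simp add: g_def)
    ultimately show "\<exists>g\<in>W. \<forall>x\<in>topspace X - U. g x = c" by blast
  qed (use V(1) in auto)
qed

text \<open>Evaluation at \<open>x\<close> is continuous, so near any \<open>f\<close> it stays below \<open>f x + 1\<close>, and only
  finitely many of the functions come near \<open>f\<close>.\<close>

lemma closed_discrete_Cp_if_evaluation_unbounded:
  assumes "x \<in> topspace X" and "\<And>n. s n \<in> topspace (Cp X)" and "\<And>n. s n x = real n"
  shows "closed_discrete (Cp X) (range s)"
proof -
  have "f \<notin> Cp X derived_set_of range s" if f: "f \<in> topspace (Cp X)" for f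
  proof -
    let ?T = "{g \<in> topspace (Cp X). g x \<in> {..<f x + 1}}"
    have "openin (Cp X) ?T"
      using continuous_map_Cp_eval[OF assms(1)]
      by (rule openin_continuous_map_preimage) simp
    moreover have "finite (range s \<inter> ?T)"
    proof (rule finite_subset)
      show "range s \<inter> ?T \<subseteq> s ` {..nat \<lceil>f x + 1\<rceil>}"
      proof
        fix g assume "g \<in> range s \<inter> ?T"
        then obtain n where "g = s n" "real n < f x + 1"
          using assms(3) by auto
        then have "n \<le> nat \<lceil>f x + 1\<rceil>" by linarith
        then show "g \<in> s ` {..nat \<lceil>f x + 1\<rceil>}" using \<open>g = s n\<close> by blast
      qed
    qed simp
    ultimately have "\<exists>T. f \<in> T \<and> openin (Cp X) T \<and> finite (range s \<inter> T)"
      using f by (intro exI[of _ ?T]) simp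
    then show ?thesis
      by (auto simp: t1_space_derived_set_of_infinite_openin[THEN iffD1, OF t1_space_Cp])
  qed
  then have "Cp X derived_set_of range s = {}"
    using derived_set_of_subset_topspace[of "Cp X" "range s"] by blast
  then show ?thesis
    using assms(2)
    by (auto simp: closed_discrete_def closedin_contains_derived_set subtopology_eq_discrete_topology_eq)
qed

text \<open>The nonzero constants \<open>1 / (n + 1)\<close> converge to zero.\<close>

lemma Cp_zero_not_isolated:
  assumes "topspace X \<noteq> {}"
  shows "\<not> openin (Cp X) {Cp_zero X}"
proof
  assume "openin (Cp X) {Cp_zero X}"
  define s where "s n = (\<lambda>x\<in>topspace X. inverse (real (Suc n)))" for n
  have s: "s n \<in> topspace (Cp X)" for n
    by (auto simp: topspace_Cp s_def
        intro!: continuous_map_eq[of X euclideanreal "\<lambda>_. inverse (real (Suc n))"])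
  moreover have "\<forall>x\<in>topspace X. (\<lambda>n. s n x) \<longlonglongrightarrow> 0"
    using LIMSEQ_inverse_real_of_nat by (simp add: s_def)
  ultimately have "limitin (Cp X) s (Cp_zero X) sequentially"
    by (simp add: limitin_Cp_zero)
  then have "\<forall>\<^sub>F n in sequentially. s n \<in> {Cp_zero X}"
    using \<open>openin (Cp X) {Cp_zero X}\<close> unfolding limitin_def by blast
  then obtain n where "s n = Cp_zero X"
    by (auto simp: eventually_sequentially)
  moreover obtain x where "x \<in> topspace X" using assms by blast
  ultimately have "s n x = 0" by (simp add: Cp_zero_def)
  then show False using \<open>x \<in> topspace X\<close> by (simp add: s_def)
qed

section \<open>The dual games of open covers, omega-covers and dense sets\<close>

text \<open>The three dualities rest on one pattern: the selectors for the moves of player I generate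
  the collection from which I chooses in the selection game, and every member of that
  collection meets every set of replies. Neighbourhoods of points generate open covers,
  neighbourhoods of finite sets generate \<open>\<omega>\<close>-covers, and points of nonempty open sets
  generate dense sets.\<close>

lemma open_covers_dual_point_open:
  "II_has_winning_strategy (G1 (open_covers X) (open_covers X)) \<longleftrightarrow>
     I_has_winning_strategy (point_open_game X)"
proof
  assume "II_has_winning_strategy (G1 (open_covers X) (open_covers X))"
  then show "I_has_winning_strategy (point_open_game X)"
  proof (rule II_wins_G1_imp_I_wins_dual)
    fix f assume f: "\<And>x. x \<in> moves_I (point_open_game X) \<Longrightarrow> f x \<in> moves_II (point_open_game X) x"
    then have "f x \<subseteq> topspace X" if "x \<in> topspace X" for x
      using that by (auto simp: point_open_game_def dest: openin_subset)
    with f show "f ` moves_I (point_open_game X) \<in> open_covers X"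
      by (fastforce simp: point_open_game_def open_covers_def)
  qed (auto simp: point_open_game_def open_covers_def)
next
  assume "I_has_winning_strategy (point_open_game X)"
  then show "II_has_winning_strategy (G1 (open_covers X) (open_covers X))"
    by (rule I_wins_dual_imp_II_wins_G1) (auto simp: point_open_game_def open_covers_def)
qed

lemma omega_covers_dual_omega_finite_open:
  "II_has_winning_strategy (G1 (omega_covers X) (omega_covers X)) \<longleftrightarrow>
     I_has_winning_strategy (omega_finite_open_game X)"
proof
  assume "II_has_winning_strategy (G1 (omega_covers X) (omega_covers X))"
  then show "I_has_winning_strategy (omega_finite_open_game X)"
  proof (rule II_wins_G1_imp_I_wins_dual)
    fix f assume f: "\<And>F. F \<in> moves_I (omega_finite_open_game X) \<Longrightarrow>
        f F \<in> moves_II (omega_finite_open_game X) F"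
    let ?\<U> = "f ` {F. finite F \<and> F \<subseteq> topspace X}"
    have f': "openin X (f F) \<and> F \<subseteq> f F" if "finite F" "F \<subseteq> topspace X" for F
      using f that by (simp add: omega_finite_open_game_def)
    have "x \<in> \<Union>?\<U>" if "x \<in> topspace X" for x
      using f'[of "{x}"] that by auto
    moreover have "U \<subseteq> topspace X" if "U \<in> ?\<U>" for U
      using that f'[THEN conjunct1, THEN openin_subset] by blast
    ultimately have "\<Union>?\<U> = topspace X" by blast
    then have "?\<U> \<in> open_covers X"
      using f' by (auto simp: open_covers_def)
    moreover have "\<exists>U\<in>?\<U>. F \<subseteq> U" if "finite F \<and> F \<subseteq> topspace X" for F
      using f' that by blast
    ultimately show "f ` moves_I (omega_finite_open_game X) \<in> omega_covers X"
      by (simp add: omega_finite_open_game_def omega_covers_def)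
  qed (auto simp: omega_finite_open_game_def)
next
  assume "I_has_winning_strategy (omega_finite_open_game X)"
  then show "II_has_winning_strategy (G1 (omega_covers X) (omega_covers X))"
  proof (rule I_wins_dual_imp_II_wins_G1)
    fix F \<U> assume "F \<in> moves_I (omega_finite_open_game X)" "\<U> \<in> omega_covers X"
    then obtain U where "U \<in> \<U>" "F \<subseteq> U" "openin X U"
      by (auto simp: omega_finite_open_game_def omega_covers_def open_covers_def)
    then show "\<U> \<inter> moves_II (omega_finite_open_game X) F \<noteq> {}"
      by (auto simp: omega_finite_open_game_def)
  qed (auto simp: omega_finite_open_game_def)
qed

lemma dense_sets_dual_CL:
  assumes "y \<in> topspace Y"
  shows "II_has_winning_strategy (G1 (dense_sets Y) (clustering_sets Y y)) \<longleftrightarrow>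
           I_has_winning_strategy (CL_game Y y)"
proof
  assume "II_has_winning_strategy (G1 (dense_sets Y) (clustering_sets Y y))"
  then show "I_has_winning_strategy (CL_game Y y)"
  proof (rule II_wins_G1_imp_I_wins_dual)
    fix f assume f: "\<And>U. U \<in> moves_I (CL_game Y y) \<Longrightarrow> f U \<in> moves_II (CL_game Y y) U"
    let ?D = "f ` {U. openin Y U \<and> U \<noteq> {}}"
    have f': "f U \<in> U" if "openin Y U" "U \<noteq> {}" for U
      using f that by (simp add: CL_game_def)
    then have "?D \<subseteq> topspace Y" using openin_subset by blast
    moreover have "Y closure_of ?D = topspace Y"
      unfolding dense_intersects_open using f' by blast
    ultimately show "f ` moves_I (CL_game Y y) \<in> dense_sets Y"
      by (simp add: CL_game_def dense_sets_def)
  qed (auto simp: CL_game_def clustering_sets_def)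
next
  assume "I_has_winning_strategy (CL_game Y y)"
  then show "II_has_winning_strategy (G1 (dense_sets Y) (clustering_sets Y y))"
  proof (rule I_wins_dual_imp_II_wins_G1)
    fix U D assume "U \<in> moves_I (CL_game Y y)" "D \<in> dense_sets Y"
    then show "D \<inter> moves_II (CL_game Y y) U \<noteq> {}"
      by (auto simp: CL_game_def dense_sets_def dense_intersects_open)
  next
    fix U s assume *: "\<And>n. U n \<in> moves_I (CL_game Y y)"
      "\<And>n. s n \<in> moves_II (CL_game Y y) (U n)" "wins_I (CL_game Y y) U s"
    have "s n \<in> topspace Y" for n
      using *(1,2)[of n] openin_subset by (auto simp: CL_game_def)
    with *(3) show "range s \<in> clustering_sets Y y"
      by (auto simp: CL_game_def clustering_sets_def)
  qed
qed

section \<open>Translations between the games\<close>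

lemma clustering_game_imp_in_closure:
  assumes "y \<in> topspace Y" and "wins_I (clustering_game Y y) U s"
  shows "y \<in> Y closure_of (range s)"
proof -
  have "\<exists>n. s n \<in> V" if "openin Y V" "y \<in> V" for V
    using assms(2) that not_finite_existsD by (fastforce simp: clustering_game_def)
  with assms(1) show ?thesis by (auto simp: in_closure_of)
qed

text \<open>A set that clusters at \<open>y\<close> meets every neighbourhood of \<open>y\<close> that player I plays.\<close>

lemma clustering_game_imp_clustering_sets:
  assumes "y \<in> topspace Y" and "I_has_winning_strategy (clustering_game Y y)"
  shows "II_has_winning_strategy (G1 (clustering_sets Y y) (clustering_sets Y y))"
  using assms(2)
proof (rule I_wins_dual_imp_II_wins_G1)
  fix U A assume "U \<in> moves_I (clustering_game Y y)" "A \<in> clustering_sets Y y"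
  then show "A \<inter> moves_II (clustering_game Y y) U \<noteq> {}"
    by (auto simp: clustering_game_def clustering_sets_def in_closure_of)
next
  fix U s assume *: "\<And>n. U n \<in> moves_I (clustering_game Y y)"
    "\<And>n. s n \<in> moves_II (clustering_game Y y) (U n)" "wins_I (clustering_game Y y) U s"
  have "s n \<in> topspace Y" for n
    using *(1,2)[of n] openin_subset by (auto simp: clustering_game_def)
  with clustering_game_imp_in_closure[OF assms(1) *(3)] show "range s \<in> clustering_sets Y y"
    by (auto simp: clustering_sets_def)
qed

lemma point_open_imp_finite_open:
  assumes "I_has_winning_strategy (point_open_game X)"
  shows "I_has_winning_strategy (finite_open_game X)"
  using assms
  by (rule I_wins_by_simulation[where mv = "\<lambda>_ x. {x}" and rp = "\<lambda>_ _ U. U"])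
     (auto simp: point_open_game_def finite_open_game_def)

lemma omega_finite_open_imp_finite_open:
  assumes "I_has_winning_strategy (omega_finite_open_game X)"
  shows "I_has_winning_strategy (finite_open_game X)"
  using assms
  by (rule I_wins_by_simulation[where mv = "\<lambda>_ F. F" and rp = "\<lambda>_ _ U. U"])
     (auto simp: omega_finite_open_game_def finite_open_game_def omega_covers_def open_covers_def)

text \<open>A finite set of points is eventually contained in II's sets, because each of its points is.\<close>

lemma eventual_finite_open_imp_omega_finite_open:
  assumes "I_has_winning_strategy (eventual_finite_open_game X)"
  shows "I_has_winning_strategy (omega_finite_open_game X)"
  using assms
proof (rule I_wins_by_simulation[where mv = "\<lambda>_ F. F" and rp = "\<lambda>_ _ U. U"])
  fix F U assume U: "\<And>n. U n \<in> moves_II (omega_finite_open_game X) (F n)"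
    and win: "wins_I (eventual_finite_open_game X) F U"
  have opn: "openin X (U n)" for n
    using U[of n] by (simp add: omega_finite_open_game_def)
  have ev: "\<forall>\<^sub>F n in sequentially. E \<subseteq> U n" if "finite E" "E \<subseteq> topspace X" for E
  proof -
    have "\<forall>\<^sub>F n in sequentially. \<forall>x\<in>E. x \<in> U n"
      using win that by (subst eventually_ball_finite_distrib) (auto simp: eventual_finite_open_game_def)
    then show ?thesis by (simp add: subset_iff Ball_def)
  qed
  have omega: "\<exists>n. E \<subseteq> U n" if "finite E" "E \<subseteq> topspace X" for E
    using ev[OF that] eventually_happens' sequentially_bot by blast
  note opn
  moreover have "\<exists>n. x \<in> U n" if "x \<in> topspace X" for x
    using omega[of "{x}"] that by simp
  moreover have "U n \<subseteq> topspace X" for n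
    using opn by (rule openin_subset)
  ultimately have "range U \<in> open_covers X"
    by (auto simp: open_covers_def)
  with omega show "wins_I (omega_finite_open_game X) F U"
    by (simp add: omega_finite_open_game_def omega_covers_def)
qed (auto simp: omega_finite_open_game_def eventual_finite_open_game_def)

text \<open>A finite set \<open>F\<close> played in round \<open>n\<close> becomes the neighbourhood of functions that are smaller
  than \<open>1 / (n + 1)\<close> on \<open>F\<close>, and the function chosen from it becomes the open set on which
  it is smaller than that bound. A point that lies in almost all of these sets is one where
  the functions converge to zero.\<close>

lemma eventual_finite_open_imp_W:
  assumes "I_has_winning_strategy (eventual_finite_open_game X)"
  shows "I_has_winning_strategy (W_game (Cp X) (Cp_zero X))"
proof (rule I_wins_by_simulation[OF assms,
      where mv = "\<lambda>n F. {g \<in> topspace (Cp X). \<forall>x\<in>F. \<bar>g x\<bar> < inverse (real (Suc n))}"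
        and rp = "\<lambda>n _ g. {x \<in> topspace X. \<bar>g x\<bar> < inverse (real (Suc n))}"])
  fix n F assume F: "F \<in> moves_I (eventual_finite_open_game X)"
  let ?e = "inverse (real (Suc n))"
  have interval: "z \<in> {-?e<..<?e} \<longleftrightarrow> \<bar>z\<bar> < ?e" for z
    by (simp only: abs_less_iff greaterThanLessThan_iff) linarith
  have fin: "finite F" "F \<subseteq> topspace X"
    using F by (auto simp: eventual_finite_open_game_def)
  have "openin (Cp X) {g \<in> topspace (Cp X). g x \<in> {-?e<..<?e}}" if "x \<in> F" for x
    using fin(2) that by (intro openin_continuous_map_preimage[OF continuous_map_Cp_eval]) auto
  then have "openin (Cp X) (topspace (Cp X) \<inter> (\<Inter>x\<in>F. {g \<in> topspace (Cp X). g x \<in> {-?e<..<?e}}))"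
    using fin(1) by (intro openin_Int_Inter) auto
  also have "topspace (Cp X) \<inter> (\<Inter>x\<in>F. {g \<in> topspace (Cp X). g x \<in> {-?e<..<?e}}) =
      {g \<in> topspace (Cp X). \<forall>x\<in>F. \<bar>g x\<bar> < ?e}"
    unfolding interval by blast
  finally show "{g \<in> topspace (Cp X). \<forall>x\<in>F. \<bar>g x\<bar> < ?e} \<in> moves_I (W_game (Cp X) (Cp_zero X))"
    using fin(2) Cp_zero_in_topspace[of X] by (auto simp: W_game_def Cp_zero_def)
next
  fix n F g
  let ?e = "inverse (real (Suc n))"
  assume "F \<in> moves_I (eventual_finite_open_game X)"
    and "g \<in> moves_II (W_game (Cp X) (Cp_zero X)) {g \<in> topspace (Cp X). \<forall>x\<in>F. \<bar>g x\<bar> < ?e}"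
  then have F: "F \<subseteq> topspace X" and g: "continuous_map X euclideanreal g" "\<forall>x\<in>F. \<bar>g x\<bar> < ?e"
    by (auto simp: eventual_finite_open_game_def W_game_def topspace_Cp)
  have "openin X {x \<in> topspace X. g x \<in> {-?e<..<?e}}"
    using g(1) by (rule openin_continuous_map_preimage) simp
  moreover have "{x \<in> topspace X. g x \<in> {-?e<..<?e}} = {x \<in> topspace X. \<bar>g x\<bar> < ?e}"
    by (intro Collect_cong conj_cong refl) (simp only: abs_less_iff greaterThanLessThan_iff, linarith)
  ultimately show "{x \<in> topspace X. \<bar>g x\<bar> < ?e} \<in> moves_II (eventual_finite_open_game X) F"
    using F g(2) by (auto simp: eventual_finite_open_game_def)
next
  fix F :: "nat \<Rightarrow> 'a set" and s
  assume s: "\<And>n. s n \<in> moves_II (W_game (Cp X) (Cp_zero X))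
      {g \<in> topspace (Cp X). \<forall>x\<in>F n. \<bar>g x\<bar> < inverse (real (Suc n))}"
    and win: "wins_I (eventual_finite_open_game X) F
      (\<lambda>n. {x \<in> topspace X. \<bar>s n x\<bar> < inverse (real (Suc n))})"
  have "(\<lambda>n. s n x) \<longlonglongrightarrow> 0" if "x \<in> topspace X" for x
  proof (rule Lim_null_comparison[OF _ LIMSEQ_inverse_real_of_nat])
    have "\<forall>\<^sub>F n in sequentially. \<bar>s n x\<bar> < inverse (real (Suc n))"
      using win that by (simp add: eventual_finite_open_game_def)
    then show "\<forall>\<^sub>F n in sequentially. norm (s n x) \<le> inverse (real (Suc n))"
      by (rule eventually_mono) simp
  qed
  moreover have "s n \<in> topspace (Cp X)" for n
    using s[of n] by (simp add: W_game_def)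
  ultimately show "wins_I (W_game (Cp X) (Cp_zero X))
      (\<lambda>n. {g \<in> topspace (Cp X). \<forall>x\<in>F n. \<bar>g x\<bar> < inverse (real (Suc n))}) s"
    by (simp add: W_game_def limitin_Cp_zero)
qed

lemma W_imp_clustering:
  assumes "I_has_winning_strategy (W_game Y y)"
  shows "I_has_winning_strategy (clustering_game Y y)"
  using assms
proof (rule I_wins_by_simulation[where mv = "\<lambda>_ U. U" and rp = "\<lambda>_ _ s. s"])
  fix U s assume "wins_I (W_game Y y) U s"
  then have "\<forall>\<^sub>F n in sequentially. s n \<in> V" if "openin Y V" "y \<in> V" for V
    using that by (auto simp: W_game_def limitin_def)
  then have "infinite {n. s n \<in> V}" if "openin Y V" "y \<in> V" for V
    using that frequently_cofinite[of "\<lambda>n. s n \<in> V"] eventually_frequently[OF sequentially_bot]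
    by (simp add: cofinite_eq_sequentially)
  then show "wins_I (clustering_game Y y) U s"
    by (simp add: clustering_game_def)
qed (auto simp: W_game_def clustering_game_def)

lemma clustering_imp_CL:
  assumes "y \<in> topspace Y" and "I_has_winning_strategy (clustering_game Y y)"
  shows "I_has_winning_strategy (CL_game Y y)"
  using assms(2)
proof (rule I_wins_by_simulation[where mv = "\<lambda>_ U. U" and rp = "\<lambda>_ _ s. s"])
  fix U s assume "wins_I (clustering_game Y y) U s"
  then show "wins_I (CL_game Y y) U s"
    using clustering_game_imp_in_closure[OF assms(1)] by (simp add: CL_game_def)
qed (auto simp: clustering_game_def CL_game_def)

text \<open>Clustering at \<open>y\<close> contradicts closedness only if \<open>y\<close> itself is not among II's points. So
  player I removes \<open>y\<close> from each open set; what remains is nonempty as \<open>y\<close> is not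
  isolated.\<close>

lemma CL_imp_CD:
  assumes "t1_space Y" and "\<not> openin Y {y}" and "I_has_winning_strategy (CL_game Y y)"
  shows "I_has_winning_strategy (CD_game Y)"
  using assms(3)
proof (rule I_wins_by_simulation[where mv = "\<lambda>_ U. U - {y}" and rp = "\<lambda>_ _ s. s"])
  fix U assume "U \<in> moves_I (CL_game Y y)"
  then have U: "openin Y U" "U \<noteq> {}" by (auto simp: CL_game_def)
  then have "U - {y} \<noteq> {}" using assms(2) by (metis Diff_eq_empty_iff subset_singletonD)
  then show "U - {y} \<in> moves_I (CD_game Y)"
    using U assms(1) by (auto simp: CD_game_def t1_space_openin_delete_alt)
next
  fix U s assume s: "\<And>n. s n \<in> moves_II (CD_game Y) (U n - {y})" and "wins_I (CL_game Y y) U s"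
  then have "y \<in> Y closure_of (range s)" by (simp add: CL_game_def)
  moreover have "y \<notin> range s"
    using s by (auto simp: CD_game_def)
  ultimately have "\<not> closedin Y (range s)"
    using closure_of_closedin by blast
  then show "wins_I (CD_game Y) (\<lambda>n. U n - {y}) s"
    by (simp add: CD_game_def closed_discrete_def)
qed (auto simp: CL_game_def CD_game_def)

text \<open>From a nonempty open set of functions player I takes the finite set of points that it
  restricts. When II answers with an open set \<open>U\<close>, the play in the function space continues
  with a function that is constantly \<open>n\<close> outside \<open>U\<close>, where \<open>n\<close> is the number of the
  round. If a point were never covered, the values there would tend to infinity and the
  functions would form a closed discrete set.\<close>

lemma CD_imp_finite_open:
  assumes "completely_regular_space X" and "I_has_winning_strategy (CD_game (Cp X))"
  shows "I_has_winning_strategy (finite_open_game X)"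
proof -
  define good where "good W F \<longleftrightarrow> finite F \<and> F \<subseteq> topspace X \<and>
      (\<forall>U c. openin X U \<and> F \<subseteq> U \<longrightarrow> (\<exists>g\<in>W. \<forall>x\<in>topspace X - U. g x = c))"
    for W :: "('a \<Rightarrow> real) set" and F
  define supp where "supp W = (SOME F. good W F)" for W
  have supp: "good W (supp W)" if "W \<in> moves_I (CD_game (Cp X))" for W
  proof -
    have W: "openin (Cp X) W" "W \<noteq> {}" using that by (auto simp: CD_game_def)
    have "\<exists>F. good W F"
    proof (rule Cp_open_set_finite_support[OF assms(1) W])
      fix F assume "finite F" "F \<subseteq> topspace X"
        and "\<And>U c. \<lbrakk>openin X U; F \<subseteq> U\<rbrakk> \<Longrightarrow> \<exists>g\<in>W. \<forall>x\<in>topspace X - U. g x = c"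
      then have "good W F" unfolding good_def by simp
      then show ?thesis ..
    qed
    then show ?thesis unfolding supp_def by (rule someI_ex)
  qed
  define bump where "bump n W U = (SOME g. g \<in> W \<and> (\<forall>x\<in>topspace X - U. g x = real n))" for n W U
  have bump: "bump n W U \<in> W \<and> (\<forall>x\<in>topspace X - U. bump n W U x = real n)"
    if "W \<in> moves_I (CD_game (Cp X))" "U \<in> moves_II (finite_open_game X) (supp W)" for n W U
  proof -
    have "\<exists>g. g \<in> W \<and> (\<forall>x\<in>topspace X - U. g x = real n)"
      using supp[OF that(1)] that(2) unfolding good_def Bex_def by (simp add: finite_open_game_def)
    then show ?thesis unfolding bump_def by (rule someI_ex)
  qed
  show ?thesis
  proof (rule I_wins_by_simulation[OF assms(2), where mv = "\<lambda>_. supp" and rp = bump])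
    fix W assume "W \<in> moves_I (CD_game (Cp X))"
    then show "supp W \<in> moves_I (finite_open_game X)"
      using supp[of W] by (simp add: good_def finite_open_game_def)
  next
    fix n W U assume "W \<in> moves_I (CD_game (Cp X))" "U \<in> moves_II (finite_open_game X) (supp W)"
    then show "bump n W U \<in> moves_II (CD_game (Cp X)) W"
      using bump by (simp add: CD_game_def)
  next
    fix W U
    assume W: "\<And>n. W n \<in> moves_I (CD_game (Cp X))"
      and U: "\<And>n. U n \<in> moves_II (finite_open_game X) (supp (W n))"
      and win: "wins_I (CD_game (Cp X)) W (\<lambda>n. bump n (W n) (U n))"
    let ?s = "\<lambda>n. bump n (W n) (U n)"
    have s: "?s n \<in> topspace (Cp X)" for n
    proof -
      have "W n \<subseteq> topspace (Cp X)"
        using W[of n] openin_subset by (auto simp: CD_game_def)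
      with bump[OF W U, of n n] show ?thesis by blast
    qed
    have "x \<in> (\<Union>n. U n)" if x: "x \<in> topspace X" for x
    proof (rule ccontr)
      assume "x \<notin> (\<Union>n. U n)"
      then have "?s n x = real n" for n
        using bump[OF W U, of n n] x by blast
      then have "closed_discrete (Cp X) (range ?s)"
        by (rule closed_discrete_Cp_if_evaluation_unbounded[OF x s])
      with win show False by (simp add: CD_game_def)
    qed
    moreover have "U n \<subseteq> topspace X" for n
      using U[of n] openin_subset by (auto simp: finite_open_game_def)
    ultimately show "wins_I (finite_open_game X) (\<lambda>n. supp (W n)) U"
      by (auto simp: finite_open_game_def)
  qed
qed

section \<open>Equivalence of the eleven games\<close>

theorem theorem15:
  fixes X :: "'a topology"
  assumes "topspace X \<noteq> {}"
    and "completely_regular_space X"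
    and "t1_space X"
  shows "(II_has_winning_strategy (G1 (open_covers X) (open_covers X)) \<longleftrightarrow>
          II_has_winning_strategy (G1 (omega_covers X) (omega_covers X))) \<and>
         (II_has_winning_strategy (G1 (omega_covers X) (omega_covers X)) \<longleftrightarrow>
          I_has_winning_strategy (point_open_game X)) \<and>
         (I_has_winning_strategy (point_open_game X) \<longleftrightarrow>
          I_has_winning_strategy (finite_open_game X)) \<and>
         (I_has_winning_strategy (finite_open_game X) \<longleftrightarrow>
          I_has_winning_strategy (omega_finite_open_game X)) \<and>
         (I_has_winning_strategy (omega_finite_open_game X) \<longleftrightarrow>
          I_has_winning_strategy (W_game (Cp X) (Cp_zero X))) \<and>
         (I_has_winning_strategy (W_game (Cp X) (Cp_zero X)) \<longleftrightarrow>
          I_has_winning_strategy (clustering_game (Cp X) (Cp_zero X))) \<and>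
         (I_has_winning_strategy (clustering_game (Cp X) (Cp_zero X)) \<longleftrightarrow>
          I_has_winning_strategy (CL_game (Cp X) (Cp_zero X))) \<and>
         (I_has_winning_strategy (CL_game (Cp X) (Cp_zero X)) \<longleftrightarrow>
          I_has_winning_strategy (CD_game (Cp X))) \<and>
         (I_has_winning_strategy (CD_game (Cp X)) \<longleftrightarrow>
          II_has_winning_strategy (G1 (clustering_sets (Cp X) (Cp_zero X)) (clustering_sets (Cp X) (Cp_zero X)))) \<and>
         (II_has_winning_strategy (G1 (clustering_sets (Cp X) (Cp_zero X)) (clustering_sets (Cp X) (Cp_zero X))) \<longleftrightarrow>
          II_has_winning_strategy (G1 (dense_sets (Cp X)) (clustering_sets (Cp X) (Cp_zero X))))"
proof -
  note zero = Cp_zero_in_topspace[of X]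
  have a_c: "II_has_winning_strategy (G1 (open_covers X) (open_covers X)) \<longleftrightarrow>
      I_has_winning_strategy (point_open_game X)"
    by (rule open_covers_dual_point_open)
  have b_e: "II_has_winning_strategy (G1 (omega_covers X) (omega_covers X)) \<longleftrightarrow>
      I_has_winning_strategy (omega_finite_open_game X)"
    by (rule omega_covers_dual_omega_finite_open)
  have k_h: "II_has_winning_strategy (G1 (dense_sets (Cp X)) (clustering_sets (Cp X) (Cp_zero X))) \<longleftrightarrow>
      I_has_winning_strategy (CL_game (Cp X) (Cp_zero X))"
    by (rule dense_sets_dual_CL[OF zero])
  have c: "I_has_winning_strategy (point_open_game X) \<longleftrightarrow> I_has_winning_strategy (finite_open_game X)"
    using point_open_imp_finite_open finite_open_imp_point_open[OF assms(1)] by blast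
  have ev: "I_has_winning_strategy (finite_open_game X) \<Longrightarrow>
      I_has_winning_strategy (eventual_finite_open_game X)"
    by (rule finite_open_imp_eventual_finite_open)
  have e: "I_has_winning_strategy (omega_finite_open_game X) \<longleftrightarrow> I_has_winning_strategy (finite_open_game X)"
    using ev eventual_finite_open_imp_omega_finite_open omega_finite_open_imp_finite_open by blast
  have d_f: "I_has_winning_strategy (finite_open_game X) \<Longrightarrow>
      I_has_winning_strategy (W_game (Cp X) (Cp_zero X))"
    using ev eventual_finite_open_imp_W by blast
  note f_g = W_imp_clustering[of "Cp X" "Cp_zero X"]
  note g_h = clustering_imp_CL[OF zero]
  note h_i = CL_imp_CD[OF t1_space_Cp Cp_zero_not_isolated[OF assms(1)]]
  note i_d = CD_imp_finite_open[OF assms(2)]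
  have f: "I_has_winning_strategy (W_game (Cp X) (Cp_zero X)) \<longleftrightarrow> I_has_winning_strategy (finite_open_game X)"
    using d_f f_g g_h h_i i_d by blast
  have g: "I_has_winning_strategy (clustering_game (Cp X) (Cp_zero X)) \<longleftrightarrow> I_has_winning_strategy (finite_open_game X)"
    using d_f f_g g_h h_i i_d by blast
  have h: "I_has_winning_strategy (CL_game (Cp X) (Cp_zero X)) \<longleftrightarrow> I_has_winning_strategy (finite_open_game X)"
    using d_f f_g g_h h_i i_d by blast
  have i: "I_has_winning_strategy (CD_game (Cp X)) \<longleftrightarrow> I_has_winning_strategy (finite_open_game X)"
    using d_f f_g g_h h_i i_d by blast
  have "dense_sets (Cp X) \<subseteq> clustering_sets (Cp X) (Cp_zero X)"
    using zero by (auto simp: dense_sets_def clustering_sets_def)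
  then have j: "II_has_winning_strategy (G1 (clustering_sets (Cp X) (Cp_zero X)) (clustering_sets (Cp X) (Cp_zero X))) \<longleftrightarrow>
      I_has_winning_strategy (finite_open_game X)"
    using g h k_h clustering_game_imp_clustering_sets[OF zero] II_wins_G1_antimono by metis
  show ?thesis
    unfolding a_c b_e k_h c e f g h i j by simp
qed

end
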